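(* Let $k$ be a positive integer, let $c(n,k)$ be defined by $(1-k^2x)^{-1/k}=\sum_{n\ge 0}c(n,k)x^n$, and let $p$ be a prime not dividing $k$. Write $n=a_0+a_1p+\cdots+a_dp^d$ in base $p$ (digits $0\le a_j\le p-1$), and write the $p$-adic integer $1/k$ as $1/k=1+\sum_{j\ge 0}b_jp^j$ with digits $0\le b_j\le p-1$. Then $p\nmid c(n,k)$ if and only if $a_j+b_j<p$ for all $j$ with $0\le j\le d$.
   Context: Since $p\nmid k$, $k$ is invertible in the ring $\mathbb{Z}_p$ of $p$-adic integers, and $1/k-1\in\mathbb{Z}_p$ has a unique $p$-adic digit expansion $\sum_{j\ge0}b_jp^j$ with $b_j\in\{0,\dots,p-1\}$; these are the $b_j$. *)

theory Defs
  imports "HOL-Analysis.Analysis" "HOL-Algebra.Ring" "HOL-Number_Theory.Cong"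
begin

text \<open>
  The formal power series \<open>(1 - k\<^sup>2 x)^(-1/k)\<close> over the rationals, obtained by substituting
  \<open>-k\<^sup>2 x\<close> for \<open>y\<close> in the binomial series of \<open>(1 + y)^(-1/k)\<close>. The lemma after it confirms
  that this is the inverse \<open>k\<close>-th root of \<open>1 - k\<^sup>2 x\<close> with constant term 1.
\<close>

definition root_series :: "nat \<Rightarrow> rat fps" where
  "root_series k =
     fps_compose (fps_binomial (- 1 / of_nat k)) (- fps_const (of_nat (k\<^sup>2)) * fps_X)"

definition coeff_c :: "nat \<Rightarrow> nat \<Rightarrow> rat" where
  "coeff_c n k = fps_nth (root_series k) n"

lemma root_series_power:
  assumes "k > 0"
  shows "root_series k ^ k * (1 - fps_const (of_nat (k\<^sup>2)) * fps_X) = 1"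
    and "fps_nth (root_series k) 0 = 1"
proof -
  let ?y = "- fps_const (of_nat (k\<^sup>2)) * fps_X :: rat fps"
  have y0: "fps_nth ?y 0 = 0"
    by simp
  have "root_series k ^ k = fps_compose (fps_binomial (- 1)) ?y"
    unfolding root_series_def fps_compose_power [OF y0] fps_binomial_power
    using assms by simp
  moreover have "1 - fps_const (of_nat (k\<^sup>2)) * fps_X = fps_compose (fps_binomial 1) ?y"
    by (simp add: fps_binomial_1 fps_compose_add_distrib)
  ultimately have "root_series k ^ k * (1 - fps_const (of_nat (k\<^sup>2)) * fps_X)
      = fps_compose (fps_binomial (- 1) * fps_binomial 1) ?y"
    using fps_compose_mult_distrib [OF y0] by metis
  also have "fps_binomial (- 1) * fps_binomial 1 = (1 :: rat fps)"
    by (simp flip: fps_binomial_add_mult)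
  finally show "root_series k ^ k * (1 - fps_const (of_nat (k\<^sup>2)) * fps_X) = 1"
    by simp
  show "fps_nth (root_series k) 0 = 1"
    by (simp add: root_series_def)
qed

text \<open>
  The ring of \<open>p\<close>-adic integers as the inverse limit of the rings of integers modulo \<open>p ^ m\<close>.
  Its elements are the coherent sequences of residues, the \<open>m\<close>-th one taken in
  \<open>{0..<p ^ m}\<close> (so the entry at \<open>m = 0\<close> is always 0).
\<close>

definition padic_integers :: "nat \<Rightarrow> (nat \<Rightarrow> int) ring" where
  "padic_integers p = \<lparr>
     carrier = {x. \<forall>m. x m \<in> {0..<int p ^ m} \<and> x (Suc m) mod int p ^ m = x m},
     mult = (\<lambda>x y m. (x m * y m) mod int p ^ m),
     one = (\<lambda>m. 1 mod int p ^ m),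
     zero = (\<lambda>m. 0),
     add = (\<lambda>x y m. (x m + y m) mod int p ^ m)\<rparr>"

definition padic_of_int :: "nat \<Rightarrow> int \<Rightarrow> nat \<Rightarrow> int" where
  "padic_of_int p z = (\<lambda>m. z mod int p ^ m)"

text \<open>The inverse limit topology, which is the \<open>p\<close>-adic topology.\<close>

definition padic_topology :: "nat \<Rightarrow> (nat \<Rightarrow> int) topology" where
  "padic_topology p =
     subtopology (product_topology (\<lambda>m. discrete_topology UNIV) UNIV)
       (carrier (padic_integers p))"

definition padic_digit_expansion :: "nat \<Rightarrow> (nat \<Rightarrow> nat) \<Rightarrow> (nat \<Rightarrow> int) \<Rightarrow> bool" where
  "padic_digit_expansion p b s \<longleftrightarrow>
     (\<forall>j. b j < p) \<and>
     limitin (padic_topology p) (\<lambda>N. padic_of_int p (int (\<Sum>j<N. b j * p ^ j))) s sequentially"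

lemma mod_power_Suc_mod: "(z :: int) mod (q ^ Suc m) mod q ^ m = z mod q ^ m"
  by (rule mod_mod_cancel) simp

lemma padic_of_int_closed:
  assumes "p > 0"
  shows "padic_of_int p z \<in> carrier (padic_integers p)"
  using assms by (simp add: padic_integers_def padic_of_int_def mod_power_Suc_mod del: power_Suc)

lemma padic_carrier_mod:
  assumes "x \<in> carrier (padic_integers p)"
  shows "x m mod int p ^ m = x m"
  using assms by (simp add: padic_integers_def)

lemma padic_carrierI:
  assumes "p > 0" "\<And>m. f (Suc m) mod int p ^ m = f m mod int p ^ m"
  shows "(\<lambda>m. f m mod int p ^ m) \<in> carrier (padic_integers p)"
  using assms by (simp add: padic_integers_def mod_power_Suc_mod del: power_Suc)

lemma padic_carrier_Suc:
  assumes "x \<in> carrier (padic_integers p)"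
  shows "x (Suc m) mod int p ^ m = x m mod int p ^ m"
  using assms by (simp add: padic_integers_def)

lemma padic_integers_cring:
  assumes "p > 0"
  shows "cring (padic_integers p)"
proof (rule cringI)
  let ?R = "padic_integers p"
  note ops = padic_integers_def
  have add_closed: "x \<oplus>\<^bsub>?R\<^esub> y \<in> carrier ?R"
    if "x \<in> carrier ?R" "y \<in> carrier ?R" for x y
  proof -
    have "(\<lambda>m. (x m + y m) mod int p ^ m) \<in> carrier ?R"
      by (rule padic_carrierI [OF assms], rule mod_add_cong)
         (auto intro: padic_carrier_Suc that)
    then show ?thesis by (simp add: ops)
  qed
  have mult_closed: "x \<otimes>\<^bsub>?R\<^esub> y \<in> carrier ?R"
    if "x \<in> carrier ?R" "y \<in> carrier ?R" for x y
  proof -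
    have "(\<lambda>m. (x m * y m) mod int p ^ m) \<in> carrier ?R"
      by (rule padic_carrierI [OF assms], rule mod_mult_cong)
         (auto intro: padic_carrier_Suc that)
    then show ?thesis by (simp add: ops)
  qed
  have zero_closed: "\<zero>\<^bsub>?R\<^esub> \<in> carrier ?R"
    using assms by (simp add: ops)
  have one_closed: "\<one>\<^bsub>?R\<^esub> \<in> carrier ?R"
    using padic_of_int_closed [OF assms, of 1] by (simp add: ops padic_of_int_def)
  have neg: "\<exists>y \<in> carrier ?R. y \<oplus>\<^bsub>?R\<^esub> x = \<zero>\<^bsub>?R\<^esub>" if "x \<in> carrier ?R" for x
  proof
    show "(\<lambda>m. (- x m) mod int p ^ m) \<in> carrier ?R"
      by (rule padic_carrierI [OF assms], rule mod_minus_cong) (rule padic_carrier_Suc [OF that])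
    show "(\<lambda>m. (- x m) mod int p ^ m) \<oplus>\<^bsub>?R\<^esub> x = \<zero>\<^bsub>?R\<^esub>"
      by (simp add: ops mod_add_left_eq)
  qed
  show "abelian_group ?R"
  proof (rule abelian_groupI)
    fix x y z
    show "(x \<oplus>\<^bsub>?R\<^esub> y) \<oplus>\<^bsub>?R\<^esub> z = x \<oplus>\<^bsub>?R\<^esub> (y \<oplus>\<^bsub>?R\<^esub> z)"
      by (simp add: ops mod_simps add.assoc)
    show "x \<oplus>\<^bsub>?R\<^esub> y = y \<oplus>\<^bsub>?R\<^esub> x"
      by (simp add: ops add.commute)
  next
    fix x assume "x \<in> carrier ?R"
    from padic_carrier_mod [OF this] show "\<zero>\<^bsub>?R\<^esub> \<oplus>\<^bsub>?R\<^esub> x = x"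
      by (simp add: ops)
  qed (use add_closed zero_closed neg in auto)
  show "Group.comm_monoid ?R"
  proof (rule comm_monoidI)
    fix x y z
    show "(x \<otimes>\<^bsub>?R\<^esub> y) \<otimes>\<^bsub>?R\<^esub> z = x \<otimes>\<^bsub>?R\<^esub> (y \<otimes>\<^bsub>?R\<^esub> z)"
      by (simp add: ops mod_simps mult.assoc)
    show "x \<otimes>\<^bsub>?R\<^esub> y = y \<otimes>\<^bsub>?R\<^esub> x"
      by (simp add: ops mult.commute)
  next
    fix x assume "x \<in> carrier ?R"
    from padic_carrier_mod [OF this] show "\<one>\<^bsub>?R\<^esub> \<otimes>\<^bsub>?R\<^esub> x = x"
      by (simp add: ops mod_simps)
  qed (use mult_closed one_closed in auto)
  show "(x \<oplus>\<^bsub>?R\<^esub> y) \<otimes>\<^bsub>?R\<^esub> z = x \<otimes>\<^bsub>?R\<^esub> z \<oplus>\<^bsub>?R\<^esub> y \<otimes>\<^bsub>?R\<^esub> z" for x y z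
    by (simp add: ops mod_simps distrib_right)
qed

lemma padic_of_int_simps:
  "padic_of_int p (y + z) = padic_of_int p y \<oplus>\<^bsub>padic_integers p\<^esub> padic_of_int p z"
  "padic_of_int p (y * z) = padic_of_int p y \<otimes>\<^bsub>padic_integers p\<^esub> padic_of_int p z"
  "padic_of_int p 1 = \<one>\<^bsub>padic_integers p\<^esub>"
  by (simp_all add: padic_of_int_def padic_integers_def mod_simps)

lemma padic_of_int_unit:
  assumes "prime p" "\<not> p dvd k"
  shows "padic_of_int p (int k) \<in> Units (padic_integers p)"
proof -
  let ?R = "padic_integers p"
  have p: "p > 0"
    using assms(1) by (rule prime_gt_0_nat)
  have cop: "coprime (int k) (int p ^ m)" for m
    using assms by (metis coprime_int_iff coprime_commute coprime_power_left_iff prime_imp_coprime)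
  have "\<forall>m. \<exists>z. (int k * z) mod int p ^ m = 1 mod int p ^ m"
    using cop unfolding coprime_iff_invertible_int cong_def by blast
  then have "\<exists>f. \<forall>m. (int k * f m) mod int p ^ m = 1 mod int p ^ m"
    by (rule choice)
  then obtain f where f: "\<And>m. (int k * f m) mod int p ^ m = 1 mod int p ^ m"
    by blast
  let ?y = "\<lambda>m. f m mod int p ^ m"
  have y: "?y \<in> carrier ?R"
  proof (rule padic_carrierI [OF p])
    fix m
    have "(int k * f (Suc m)) mod int p ^ m = 1 mod int p ^ m"
      by (metis f mod_power_Suc_mod)
    with f [of m] have "[int k * f (Suc m) = int k * f m] (mod int p ^ m)"
      by (simp add: cong_def)
    then show "f (Suc m) mod int p ^ m = f m mod int p ^ m"
      using cop cong_mult_lcancel unfolding cong_def by blast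
  qed
  have "padic_of_int p (int k) \<otimes>\<^bsub>?R\<^esub> ?y = \<one>\<^bsub>?R\<^esub>"
    using f by (simp add: padic_of_int_def padic_integers_def mod_simps)
  moreover from this have "?y \<otimes>\<^bsub>?R\<^esub> padic_of_int p (int k) = \<one>\<^bsub>?R\<^esub>"
    by (simp add: padic_integers_def mult.commute)
  ultimately show ?thesis
    using y padic_of_int_closed [OF p] unfolding Units_def by blast
qed

lemma padic_digit_expansion_exists:
  assumes "p > 0" and x: "x \<in> carrier (padic_integers p)"
  shows "\<exists>b. padic_digit_expansion p b x"
proof -
  define b where "b j = nat (x (Suc j) div int p ^ j)" for j
  have range: "0 \<le> x m" "x m < int p ^ m" for m
    using x by (auto simp: padic_integers_def)
  have b: "int (b j) = x (Suc j) div int p ^ j" for j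
    using range [of "Suc j"] assms(1) by (simp add: b_def pos_imp_zdiv_nonneg_iff)
  have "x (Suc j) div int p ^ j < int p" for j
  proof -
    have "x (Suc j) div int p ^ j * int p ^ j \<le> x (Suc j)"
      using assms(1) by (simp add: minus_mod_eq_div_mult [symmetric])
    also have "\<dots> < int p * int p ^ j"
      using range(2) [of "Suc j"] by simp
    finally show ?thesis
      by (rule mult_right_less_imp_less) simp
  qed
  then have b_less: "b j < p" for j
    using b [of j] by (metis of_nat_less_iff)
  have sum: "int (\<Sum>j<N. b j * p ^ j) = x N" for N
  proof (induction N)
    case 0
    show ?case using range [of 0] by simp
  next
    case (Suc N)
    have "x (Suc N) = x (Suc N) div int p ^ N * int p ^ N + x N"
      using padic_carrier_Suc [OF x, of N] padic_carrier_mod [OF x, of N]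
      by (metis div_mult_mod_eq)
    with Suc show ?case
      by (simp add: b)
  qed
  have stable: "padic_of_int p (int (\<Sum>j<N. b j * p ^ j)) m = x m" if "m \<le> N" for m N
    unfolding sum padic_of_int_def using that
  proof (induction N rule: dec_induct)
    case base
    show ?case by (rule padic_carrier_mod [OF x])
  next
    case (step N)
    have "x (Suc N) mod int p ^ m = x (Suc N) mod int p ^ N mod int p ^ m"
      using step.hyps by (intro mod_mod_cancel [symmetric] le_imp_power_dvd)
    also have "\<dots> = x m"
      using step.IH padic_carrier_Suc [OF x, of N] padic_carrier_mod [OF x, of N] by simp
    finally show ?case .
  qed
  have lim: "limitin (discrete_topology UNIV)
      (\<lambda>N. padic_of_int p (int (\<Sum>j<N. b j * p ^ j)) m) (x m) sequentially" for m
  proof (rule limitin_eventually)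
    show "\<forall>\<^sub>F N in sequentially. padic_of_int p (int (\<Sum>j<N. b j * p ^ j)) m = x m"
      using stable unfolding eventually_sequentially by blast
  qed simp
  have "limitin (padic_topology p) (\<lambda>N. padic_of_int p (int (\<Sum>j<N. b j * p ^ j))) x sequentially"
    unfolding padic_topology_def limitin_subtopology limitin_componentwise
    using x padic_of_int_closed [OF assms(1)] lim by simp
  with b_less show ?thesis
    unfolding padic_digit_expansion_def by blast
qed

end

theory Submission
  imports Defs
begin

text \<open>
  The coefficient \<open>c(n,k)\<close> equals \<open>k\<^sup>n \<Prod>\<^bsub>i<n\<^esub>(1 + i k) / n!\<close>. If \<open>k (B + 1) \<equiv> 1\<close> modulo a
  high power of \<open>p\<close>, the product is congruent to \<open>k\<^sup>n (B+1)(B+2)\<cdots>(B+n)\<close>, so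
  \<open>c(n,k) \<equiv> k\<^bsup>2n\<^esup> binom(B+n, n)\<close> modulo \<open>p\<close>. For \<open>B\<close> one takes a long enough truncation of the
  digit expansion of \<open>1/k - 1\<close>, and by Lucas the binomial coefficient is prime to \<open>p\<close> iff
  adding \<open>B\<close> and \<open>n\<close> in base \<open>p\<close> produces no carry. Integrality of \<open>c(n,k)\<close> is checked one
  prime \<open>q\<close> at a time: for \<open>q\<close> prime to \<open>k\<close> by the same congruence, and for \<open>q\<close> dividing \<open>k\<close>
  because \<open>q\<close> occurs in \<open>n!\<close> at most \<open>n\<close> times.
\<close>

section \<open>Binomial coefficients modulo a prime: Lucas and carries\<close>

lemma prime_dvd_choose_self:
  fixes p k :: nat
  assumes "prime p" "0 < k" "k < p"
  shows "p dvd (p choose k)"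
proof -
  have "fact k * fact (p - k) * (p choose k) = (fact p :: nat)"
    using assms by (intro binomial_fact_lemma) simp
  moreover have "p dvd fact p"
    using assms(1) by (simp add: prime_dvd_fact_iff)
  moreover have "\<not> p dvd fact k" "\<not> p dvd fact (p - k)"
    using assms by (auto simp: prime_dvd_fact_iff)
  ultimately show ?thesis
    using assms(1) by (metis prime_dvd_mult_iff)
qed

text \<open>Coefficient form of (1+x)^p = 1 + x^p modulo p: in the Vandermonde sum only the terms
  \<open>j = 0\<close> and \<open>j = p\<close> survive.\<close>

lemma choose_add_prime_cong:
  fixes p n k :: nat
  assumes "prime p"
  shows "[p + n choose k = (n choose k) + (if p \<le> k then n choose (k - p) else 0)] (mod p)"
proof -
  let ?f = "\<lambda>j. (p choose j) * (n choose (k - j))"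
  let ?g = "\<lambda>j. (if j = 0 then n choose k else 0) + (if j = p then n choose (k - p) else 0)"
  have "p > 0"
    using assms by (rule prime_gt_0_nat)
  have "(p + n choose k) = (\<Sum>j\<le>k. ?f j)"
    by (simp add: vandermonde)
  also have "[\<dots> = (\<Sum>j\<le>k. ?g j)] (mod p)"
  proof (rule cong_sum)
    fix j
    consider "j = 0" | "0 < j" "j < p" | "j = p" | "p < j"
      by linarith
    then show "[?f j = ?g j] (mod p)"
    proof cases
      case 2
      then show ?thesis
        using prime_dvd_choose_self [OF assms 2] by (simp add: cong_0_iff)
    qed (use \<open>p > 0\<close> in \<open>auto simp: binomial_eq_0\<close>)
  qed
  also have "(\<Sum>j\<le>k. ?g j) = (n choose k) + (if p \<le> k then n choose (k - p) else 0)"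
    by (simp add: sum.distrib)
  finally show ?thesis .
qed

text \<open>Induction on \<open>m\<close>: adding \<open>p\<close> to the upper argument acts, by
  the previous congruence, as Pascal's rule on \<open>m choose n\<close>.\<close>

lemma lucas_step:
  fixes p m n a b :: nat
  assumes "prime p" "a < p" "b < p"
  shows "[p * m + a choose (p * n + b) = (m choose n) * (a choose b)] (mod p)"
proof (induction m arbitrary: n)
  case 0
  show ?case
    using assms by (cases n) (auto simp: binomial_eq_0)
next
  case (Suc m)
  have "p * Suc m + a = p + (p * m + a)"
    by simp
  then have *: "[p * Suc m + a choose (p * n + b) = (p * m + a choose (p * n + b)) +
      (if p \<le> p * n + b then p * m + a choose (p * n + b - p) else 0)] (mod p)"
    using choose_add_prime_cong [OF assms(1), of "p * m + a" "p * n + b"] by metis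
  show ?case
  proof (cases n)
    case 0
    then show ?thesis
      using * Suc.IH [of 0] assms by (simp split: if_splits) (metis cong_trans)
  next
    case (Suc n')
    then have "[p * Suc m + a choose (p * n + b) =
        (p * m + a choose (p * n + b)) + (p * m + a choose (p * n' + b))] (mod p)"
      using * by (simp add: algebra_simps)
    moreover have "[(p * m + a choose (p * n + b)) + (p * m + a choose (p * n' + b)) =
        (m choose n) * (a choose b) + (m choose n') * (a choose b)] (mod p)"
      by (intro cong_add Suc.IH)
    moreover have "(m choose n) * (a choose b) + (m choose n') * (a choose b) =
        (Suc m choose n) * (a choose b)"
      using Suc by (simp add: algebra_simps)
    ultimately show ?thesis
      by (metis cong_trans)
  qed
qed

text \<open>One digit of Kummer's criterion. Without a carry, Lucas splits off
  \<open>a + b choose a\<close>, which divides \<open>fact (a + b)\<close> and so is prime to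
  \<open>p\<close>.\<close>

lemma prime_dvd_choose_add_iff:
  fixes p m n a b :: nat
  assumes "prime p" "a < p" "b < p"
  shows "p dvd ((p * m + b) + (p * n + a) choose (p * n + a)) \<longleftrightarrow>
    p \<le> a + b \<or> p dvd (m + n choose n)"
proof (cases "a + b < p")
  case True
  have "[p * (m + n) + (a + b) choose (p * n + a) = (m + n choose n) * (a + b choose a)] (mod p)"
    using assms True by (intro lucas_step) auto
  moreover have "\<not> p dvd (a + b choose a)"
  proof -
    have "(a + b choose a) dvd fact (a + b)"
      by (metis binomial_fact_lemma dvd_triv_right le_add1)
    moreover have "\<not> p dvd fact (a + b)"
      using assms True by (simp add: prime_dvd_fact_iff)
    ultimately show ?thesis
      using dvd_trans by blast
  qed
  ultimately show ?thesis
    using True assms by (simp add: cong_dvd_iff prime_dvd_mult_iff algebra_simps)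
next
  case False
  \<comment> \<open>After a carry the lowest digit of the sum is \<open>r\<close>, and
    \<open>b < p\<close> forces \<open>r < a\<close>; hence the Lucas factor
    \<open>r choose a\<close> is zero.\<close>
  define r where "r = a + b - p"
  have r: "a + b = p + r" "r < a" "r < p"
    using False assms by (auto simp: r_def)
  have "[p * (m + n + 1) + r choose (p * n + a) = (m + n + 1 choose n) * (r choose a)] (mod p)"
    using assms r by (intro lucas_step) auto
  moreover have "p * (m + n + 1) + r = (p * m + b) + (p * n + a)"
    using r by (simp add: algebra_simps)
  ultimately show ?thesis
    using False r by (simp add: binomial_eq_0 cong_0_iff)
qed

lemma sum_digits_shift:
  "(\<Sum>j\<le>Suc d. a j * p ^ j) = p * (\<Sum>j\<le>d. a (Suc j) * p ^ j) + (a 0 :: nat)"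
  by (simp add: sum.atMost_Suc_shift sum_distrib_left algebra_simps del: sum.atMost_Suc)

text \<open>Peel off the lowest digit. The first carry already forces divisibility, and nothing is
  carried in before it, so testing each \<open>a j + b j\<close> separately suffices.\<close>

lemma prime_dvd_choose_add_iff_digits:
  fixes p :: nat and a b :: "nat \<Rightarrow> nat"
  assumes "prime p" "\<And>j. j \<le> d \<Longrightarrow> a j < p" "\<And>j. j \<le> d \<Longrightarrow> b j < p"
  defines "val \<equiv> (\<lambda>x. \<Sum>j\<le>d. x j * p ^ j)"
  shows "p dvd (val b + val a choose val a) \<longleftrightarrow> (\<exists>j\<le>d. p \<le> a j + b j)"
  using assms(2,3) unfolding val_def
proof (induction d arbitrary: a b)
  case 0
  then show ?case
    using prime_dvd_choose_add_iff [OF assms(1), of "a 0" "b 0" 0 0] assms(1)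
    by (auto simp: prime_nat_iff)
next
  case (Suc d)
  have "(\<exists>j\<le>Suc d. p \<le> a j + b j) \<longleftrightarrow>
      p \<le> a 0 + b 0 \<or> (\<exists>j\<le>d. p \<le> a (Suc j) + b (Suc j))"
    by (metis Suc_le_mono not0_implies_Suc zero_le)
  moreover have "a 0 < p" "b 0 < p"
    using Suc.prems by auto
  ultimately show ?case
    unfolding sum_digits_shift prime_dvd_choose_add_iff [OF assms(1) \<open>a 0 < p\<close> \<open>b 0 < p\<close>]
    using Suc.IH [of "\<lambda>j. a (Suc j)" "\<lambda>j. b (Suc j)"] Suc.prems by simp
qed

section \<open>Prime multiplicities of factorials\<close>

lemma multiplicity_fact_rec:
  fixes q :: nat
  assumes "prime q"
  shows "multiplicity q (fact n :: nat) = n div q + multiplicity q (fact (n div q) :: nat)"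
proof (induction n)
  case 0
  show ?case by simp
next
  case (Suc n)
  have mult_fact: "multiplicity q (fact (Suc m) :: nat) =
      multiplicity q (Suc m) + multiplicity q (fact m :: nat)" for m
    using assms by (subst fact_Suc, subst prime_elem_multiplicity_mult_distrib) auto
  show ?case
  \<comment> \<open>Only a multiple of \<open>q\<close> contributes: its multiplicity is one more
    than that of its quotient by \<open>q\<close>, which is exactly the new factor of
    \<open>fact (Suc n div q)\<close>.\<close>
  proof (cases "q dvd Suc n")
    case True
    then have div: "Suc n div q = Suc (n div q)"
      by (simp add: div_Suc dvd_eq_mod_eq_0)
    then have "Suc n = q * Suc (n div q)"
      using True by (metis dvd_mult_div_cancel)
    then have "multiplicity q (Suc n) = Suc (multiplicity q (Suc (n div q)))"
      using assms by (metis multiplicity_times_same nat.distinct(1) not_prime_0 not_prime_unit)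
    then show ?thesis
      unfolding div mult_fact using Suc by simp
  next
    case False
    then have "Suc n div q = n div q" "multiplicity q (Suc n) = 0"
      by (auto simp: div_Suc dvd_eq_mod_eq_0 not_dvd_imp_multiplicity_0)
    then show ?thesis
      unfolding mult_fact using Suc by simp
  qed
qed

lemma multiplicity_fact_le:
  fixes q :: nat
  assumes "prime q"
  shows "multiplicity q (fact n :: nat) \<le> n"
proof (induction n rule: less_induct)
  case (less n)
  show ?case
  proof (cases "n = 0")
    case False
    have q: "2 \<le> q"
      using assms by (rule prime_ge_2_nat)
    \<comment> \<open>By recursion and induction the multiplicity is at most twice
      \<open>n div q\<close>.\<close>
    have "n div q + n div q \<le> n div 2 + n div 2"
      using q by (intro add_mono div_le_mono2) auto
    then have "n div q + n div q \<le> n"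
      by linarith
    moreover have "n div q < n"
      using q False by simp
    ultimately show ?thesis
      using less [of "n div q"] multiplicity_fact_rec [OF assms, of n] by linarith
  qed simp
qed

section \<open>The product of the \<open>1 + i * k\<close>, and integrality of the
  coefficients\<close>

lemma pochhammer_Suc_eq_fact_choose:
  "pochhammer (Suc B) n = fact n * (B + n choose n)"
proof -
  have "fact B * pochhammer (Suc B) n = (fact (B + n) :: nat)"
    using pochhammer_product' [of "1 :: nat" B n] by (simp add: pochhammer_fact)
  also have "\<dots> = fact B * (fact n * (B + n choose n))"
    using binomial_fact_lemma [of n "B + n"] by (simp add: algebra_simps)
  finally show ?thesis by simp
qed

text \<open>Replacing 1 by \<open>k * Suc B\<close> turns each factor into
  \<open>k * (Suc B + i)\<close>, leaving a rising factorial. The modulus is general so as to serve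
  powers of every prime not dividing \<open>k\<close>.\<close>

lemma prod_progression_cong:
  fixes k B m n :: nat
  assumes "[k * Suc B = 1] (mod m)"
  shows "[(\<Prod>i<n. 1 + i * k) = k ^ n * (fact n * (B + n choose n))] (mod m)"
proof -
  have "[(\<Prod>i<n. 1 + i * k) = (\<Prod>i<n. k * Suc B + i * k)] (mod m)"
    using assms by (intro cong_prod cong_add) (auto simp: cong_sym)
  also have "(\<Prod>i<n. k * Suc B + i * k) = (\<Prod>i<n. k * (Suc B + i))"
    by (simp add: algebra_simps)
  also have "\<dots> = k ^ n * pochhammer (Suc B) n"
    unfolding prod.distrib pochhammer_prod by (simp add: atLeast0LessThan)
  finally show ?thesis
    by (simp only: pochhammer_Suc_eq_fact_choose)
qed

lemma fact_dvd_power_mult_prod_progression: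
  fixes k n :: nat
  assumes "k > 0"
  shows "fact n dvd k ^ n * (\<Prod>i<n. 1 + i * k)"
proof (rule multiplicity_le_imp_dvd)
  fix q :: nat
  assume q: "prime q"
  define v where "v = multiplicity q (fact n :: nat)"
  have nz: "k ^ n * (\<Prod>i<n. 1 + i * k) \<noteq> 0"
    using assms by simp
  have "q ^ v dvd k ^ n * (\<Prod>i<n. 1 + i * k)"
  proof (cases "q dvd k")
    case True
    have "q ^ v dvd q ^ n"
      unfolding v_def by (intro le_imp_power_dvd multiplicity_fact_le q)
    also have "q ^ n dvd k ^ n"
      using True by (rule dvd_power_same)
    finally show ?thesis by simp
  next
    case False
    then have "coprime k (q ^ v)"
      using q by (metis coprime_commute coprime_power_left_iff prime_imp_coprime)
    then obtain t where t: "[k * t = 1] (mod q ^ v)"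
      using cong_solve_coprime_nat [of k "q ^ v"] unfolding One_nat_def by blast
    \<comment> \<open>Adding \<open>q ^ v\<close> keeps the residue of \<open>t\<close> and makes
      the predecessor safe even when \<open>t = 0\<close>.\<close>
    define B where "B = t + q ^ v - 1"
    have "q ^ v > 0"
      using q by (simp add: prime_gt_0_nat)
    then have "Suc B = t + q ^ v"
      by (simp add: B_def)
    then have "[k * Suc B = 1] (mod q ^ v)"
      using t by (simp add: cong_def algebra_simps)
    then have "[(\<Prod>i<n. 1 + i * k) = k ^ n * (fact n * (B + n choose n))] (mod q ^ v)"
      by (rule prod_progression_cong)
    moreover have "q ^ v dvd k ^ n * (fact n * (B + n choose n))"
      unfolding v_def by (intro dvd_mult dvd_mult2 multiplicity_dvd)
    ultimately have "q ^ v dvd (\<Prod>i<n. 1 + i * k)"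
      by (simp add: cong_dvd_iff cong_def mod_eq_0_iff_dvd [symmetric])
    then show ?thesis by simp
  qed
  then show "multiplicity q (fact n) \<le> multiplicity q (k ^ n * (\<Prod>i<n. 1 + i * k))"
    using nz q unfolding v_def by (intro multiplicity_geI) auto
qed simp

lemma coeff_c_mult_fact:
  assumes "k > 0"
  shows "coeff_c n k * fact n = of_nat (k ^ n * (\<Prod>i<n. 1 + i * k))"
proof -
  let ?K = "of_nat k :: rat"
  have "coeff_c n k = (- ?K\<^sup>2) ^ n * ((- 1 / ?K) gchoose n)"
    unfolding coeff_c_def root_series_def
    by (metis fps_binomial_nth fps_const_neg fps_nth_compose_linear of_nat_power)
  then have "coeff_c n k * fact n = (- ?K\<^sup>2) ^ n * (((- 1 / ?K) gchoose n) * fact n)"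
    by simp
  \<comment> \<open>The factorial turns the generalized binomial into a falling product; giving each
    factor one \<open>- ?K\<^sup>2\<close> clears its denominator.\<close>
  also have "\<dots> = (\<Prod>i<n. (- ?K\<^sup>2) * (- 1 / ?K - of_nat i))"
    unfolding gbinomial_mult_fact' prod.distrib by (simp add: atLeast0LessThan)
  also have "\<dots> = (\<Prod>i<n. ?K * (1 + of_nat i * ?K))"
    using assms by (intro prod.cong) (auto simp: field_simps power2_eq_square)
  finally show ?thesis
    by (simp add: prod.distrib)
qed

section \<open>Truncated digit expansions as inverses modulo powers of \<open>p\<close>\<close>

lemma padic_digit_expansion_cong:
  assumes "padic_digit_expansion p b s"
  shows "[s m = int (\<Sum>j<m. b j * p ^ j)] (mod int p ^ m)"
proof -
  have "limitin (padic_topology p) (\<lambda>N. padic_of_int p (int (\<Sum>j<N. b j * p ^ j))) s sequentially"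
    using assms by (simp add: padic_digit_expansion_def)
  then have "limitin (discrete_topology UNIV)
      (\<lambda>N. padic_of_int p (int (\<Sum>j<N. b j * p ^ j)) m) (s m) sequentially"
    by (simp add: padic_topology_def limitin_subtopology limitin_componentwise)
  \<comment> \<open>Entry \<open>m\<close> lives in a discrete space: \<open>{s m}\<close> is open,
    so convergence means eventual equality.\<close>
  then have "\<forall>\<^sub>F N in sequentially. padic_of_int p (int (\<Sum>j<N. b j * p ^ j)) m = s m"
    by (auto simp: limitin_def dest: spec [of _ "{s m}"])
  then have "\<forall>\<^sub>F N in sequentially. m \<le> N \<and> padic_of_int p (int (\<Sum>j<N. b j * p ^ j)) m = s m"
    using eventually_ge_at_top [of m] by eventually_elim simp
  then obtain N where "m \<le> N" and N: "padic_of_int p (int (\<Sum>j<N. b j * p ^ j)) m = s m"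
    using eventually_happens' [OF sequentially_bot] by blast
  \<comment> \<open>The terms from index \<open>m\<close> on are multiples of \<open>p ^ m\<close>,
    so cutting the sum there keeps the residue.\<close>
  have "(\<Sum>j<N. b j * p ^ j) = (\<Sum>j<m. b j * p ^ j) + (\<Sum>j=m..<N. b j * p ^ j)"
    using sum.atLeastLessThan_concat [of 0 m N "\<lambda>j. b j * p ^ j"] \<open>m \<le> N\<close>
    by (simp add: atLeast0LessThan)
  moreover have "p ^ m dvd (\<Sum>j=m..<N. b j * p ^ j)"
    by (intro dvd_sum dvd_mult le_imp_power_dvd) auto
  ultimately have "[(\<Sum>j<N. b j * p ^ j) = (\<Sum>j<m. b j * p ^ j)] (mod p ^ m)"
    by (auto simp: cong_def mod_eq_0_iff_dvd elim!: dvdE)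
  then have "[int (\<Sum>j<N. b j * p ^ j) = int (\<Sum>j<m. b j * p ^ j)] (mod int p ^ m)"
    by (metis cong_int_iff of_nat_power)
  then show "[s m = int (\<Sum>j<m. b j * p ^ j)] (mod int p ^ m)"
    using N unfolding padic_of_int_def cong_def by (metis mod_mod_trivial)
qed

text \<open>Entry \<open>m\<close> of the ring identity k(1 + s) = 1 is a congruence modulo
  \<open>p ^ m\<close>, in which \<open>s m\<close> may be replaced by the truncated sum.\<close>

lemma inverse_digit_truncation_cong:
  assumes "prime p" "\<not> p dvd k" "padic_digit_expansion p b s"
    and inv: "inv\<^bsub>padic_integers p\<^esub> (padic_of_int p (int k)) =
      \<one>\<^bsub>padic_integers p\<^esub> \<oplus>\<^bsub>padic_integers p\<^esub> s"
  shows "[k * Suc (\<Sum>j<m. b j * p ^ j) = 1] (mod p ^ m)"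
proof -
  let ?R = "padic_integers p"
  let ?B = "\<Sum>j<m. b j * p ^ j"
  have p: "p > 0"
    using assms(1) by (rule prime_gt_0_nat)
  interpret cring ?R
    using p by (rule padic_integers_cring)
  have "padic_of_int p (int k) \<otimes>\<^bsub>?R\<^esub> inv\<^bsub>?R\<^esub> (padic_of_int p (int k)) = \<one>\<^bsub>?R\<^esub>"
    using padic_of_int_unit [OF assms(1,2)] by (rule Units_r_inv)
  then have "(padic_of_int p (int k) \<otimes>\<^bsub>?R\<^esub> (\<one>\<^bsub>?R\<^esub> \<oplus>\<^bsub>?R\<^esub> s)) m = \<one>\<^bsub>?R\<^esub> m"
    using inv by simp
  then have "[int k * (1 + s m) = 1] (mod int p ^ m)"
    by (simp add: padic_integers_def padic_of_int_def cong_def mod_simps)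
  moreover have "[int k * (1 + s m) = int k * (1 + int ?B)] (mod int p ^ m)"
    by (intro cong_mult cong_add cong_refl padic_digit_expansion_cong [OF assms(3)])
  ultimately have "[int k * (1 + int ?B) = 1] (mod int p ^ m)"
    using cong_sym cong_trans by blast
  then have "[int (k * Suc ?B) = int 1] (mod int (p ^ m))"
    by (simp only: of_nat_mult of_nat_power of_nat_Suc of_nat_1 add.commute)
  then show ?thesis
    by (simp only: cong_int_iff)
qed

text \<open>
  The modulus \<open>p\<^sup>M\<close> exceeds \<open>n!\<close>, so dividing the congruence for \<open>n! c\<close> by \<open>n!\<close> leaves at
  least one factor \<open>p\<close>.
\<close>

lemma coeff_c_cong_choose:
  fixes c :: nat
  assumes "prime p" "[k * Suc B = 1] (mod p ^ M)" "fact n < p ^ M"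
    and "c * fact n = k ^ n * (\<Prod>i<n. 1 + i * k)"
  shows "[c = k ^ n * k ^ n * (B + n choose n)] (mod p)"
proof -
  let ?X = "k ^ n * k ^ n * (B + n choose n)"
  have "[c * fact n = k ^ n * (k ^ n * (fact n * (B + n choose n)))] (mod p ^ M)"
    unfolding assms(4) by (intro cong_mult cong_refl prod_progression_cong assms(2))
  then have "[int (c * fact n) = int (?X * fact n)] (mod int (p ^ M))"
    by (simp only: cong_int_iff mult_ac)
  then have dvd: "int p ^ M dvd fact n * (int c - int ?X)"
    by (simp add: cong_iff_dvd_diff algebra_simps)
  have "int p dvd int c - int ?X"
  proof (rule ccontr)
    assume "\<not> int p dvd int c - int ?X"
    then have "coprime (int p ^ M) (int c - int ?X)"
      using assms(1) by (metis coprime_power_left_iff prime_imp_coprime prime_nat_int_transfer)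
    then have "int p ^ M dvd fact n"
      using dvd by (simp add: coprime_dvd_mult_left_iff)
    then have "int (p ^ M) dvd int (fact n)"
      by simp
    then have "p ^ M dvd fact n"
      by (simp only: int_dvd_int_iff)
    then show False
      using assms(3) dvd_imp_le [of "p ^ M" "fact n"] by simp
  qed
  then show ?thesis
    by (metis cong_iff_dvd_diff cong_int_iff)
qed

section \<open>From the binomial congruence to the digit criterion\<close>

theorem theorem3p2:
  fixes k p n d :: nat and a b :: "nat \<Rightarrow> nat" and s :: "nat \<Rightarrow> int"
  assumes "k > 0" and "prime p" and "\<not> p dvd k"
    and "\<forall>j\<le>d. a j < p" and "n = (\<Sum>j\<le>d. a j * p ^ j)"
    and "padic_digit_expansion p b s"
    and "inv\<^bsub>padic_integers p\<^esub> (padic_of_int p (int k)) = \<one>\<^bsub>padic_integers p\<^esub> \<oplus>\<^bsub>padic_integers p\<^esub> s"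
  shows "\<exists>z :: int. coeff_c n k = of_int z \<and> (\<not> int p dvd z \<longleftrightarrow> (\<forall>j\<le>d. a j + b j < p))"
proof -
  obtain c where "k ^ n * (\<Prod>i<n. 1 + i * k) = fact n * c"
    using fact_dvd_power_mult_prod_progression [OF assms(1), of n] by (elim dvdE)
  then have c: "c * fact n = k ^ n * (\<Prod>i<n. 1 + i * k)"
    by simp
  have "coeff_c n k * fact n = of_nat (c * fact n)"
    unfolding c by (rule coeff_c_mult_fact [OF assms(1)])
  then have coeff: "coeff_c n k = of_nat c"
    by simp
  \<comment> \<open>This \<open>e\<close> is at least \<open>d\<close>, and large enough that
    \<open>p ^ Suc e\<close> exceeds \<open>fact n\<close>. Padding \<open>a\<close> with zeros up
    to \<open>e\<close> gives \<open>n\<close> and \<open>B\<close> the same digit range.\<close>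
  define e where "e = d + fact n"
  define B where "B = (\<Sum>j\<le>e. b j * p ^ j)"
  define a' where "a' j = (if j \<le> d then a j else 0)" for j
  have p: "p > 1"
    using assms(2) by (rule prime_gt_1_nat)
  have b: "b j < p" for j
    using assms(6) by (simp add: padic_digit_expansion_def)
  have n: "n = (\<Sum>j\<le>e. a' j * p ^ j)"
    unfolding assms(5) by (intro sum.mono_neutral_cong_left) (auto simp: a'_def e_def)
  have "[k * Suc B = 1] (mod p ^ Suc e)"
    using inverse_digit_truncation_cong [OF assms(2,3,6,7), of "Suc e"]
    by (simp only: B_def lessThan_Suc_atMost)
  moreover have "fact n < p ^ Suc e"
  proof -
    have "fact n < Suc e"
      by (simp add: e_def)
    also have "Suc e < 2 ^ Suc e"
      by (rule less_exp)
    also have "\<dots> \<le> p ^ Suc e"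
      using p by (intro power_mono) auto
    finally show ?thesis .
  qed
  ultimately have "[c = k ^ n * k ^ n * (B + n choose n)] (mod p)"
    using coeff_c_cong_choose assms(2) c by blast
  moreover have "\<not> p dvd k ^ n * k ^ n"
    using assms(2,3) prime_dvd_power_nat by (auto simp: prime_dvd_mult_iff)
  ultimately have "p dvd c \<longleftrightarrow> p dvd (B + n choose n)"
    using assms(2) by (simp add: cong_dvd_iff prime_dvd_mult_iff)
  also have "\<dots> \<longleftrightarrow> (\<exists>j\<le>e. p \<le> a' j + b j)"
    unfolding n B_def using assms(4) p b
    by (intro prime_dvd_choose_add_iff_digits assms(2)) (auto simp: a'_def)
  also have "\<dots> \<longleftrightarrow> (\<exists>j\<le>d. p \<le> a j + b j)"
  proof -
    \<comment> \<open>Beyond \<open>d\<close> the padded digit is 0 and \<open>b j < p\<close>, so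
      no position there reaches \<open>p\<close>.\<close>
    have "j \<le> e \<and> p \<le> a' j + b j \<longleftrightarrow> j \<le> d \<and> p \<le> a j + b j" for j
      using b [of j] by (auto simp: a'_def e_def)
    then show ?thesis by simp
  qed
  finally have "\<not> int p dvd int c \<longleftrightarrow> (\<forall>j\<le>d. a j + b j < p)"
    by (metis int_dvd_int_iff linorder_not_le)
  then show ?thesis
    using coeff by (intro exI [of _ "int c"]) simp
qed

end
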